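(* For every $\theta>1$, every block $B\subseteq\{1,\dots,m\}$ of the partition $\mathcal B$, and every $\lambda\in\mathbb R^m$, $$H_{BB}(\lambda)\preceq c_\theta H^\star_{BB}+\frac{\theta\rho_B^2}{\gamma^2}F(\lambda)\,I_B,\qquad c_\theta=\theta\log\frac{\theta}{\theta-1}.$$ In particular, for any $\bar H_B\ge\|H^\star_{BB}\|_2$, the choice $\kappa_B=2\log 2\,\bar H_B$ and $\nu_B=2\rho_B^2/\gamma^2$ satisfies $$\nabla^2_{BB}\phi_{\rm se}(\lambda)\preceq(\kappa_B+\nu_BF(\lambda))I_B\qquad\text{for every }\lambda\in\mathbb R^m.$$ No sign assumption on $A$ is required.
   Context: Let $A\in\mathbb R^{m\times n}$ with columns $a_1,\dots,a_n$, $b\in\mathbb R^m$, $c\in\mathbb R^n$, $\gamma>0$. Standing assumption: there is $q\in\mathbb R^m$ with $A^\top q=\mathbf 1$ and $\langle q,b\rangle=1$, and there is $\bar x\in\mathbb R^n$ with all entries positive and $A\bar x=b$. The sum-exp dual is $\phi_{\rm se}(\lambda)=-\langle b,\lambda\rangle+\gamma\sum_{j=1}^n\exp((a_j^\top\lambda-c_j)/\gamma)$, $\lambda\in\mathbb R^m$; its minimum $\phi_{\rm se}^\star$ is attained, and $F=\phi_{\rm se}-\phi_{\rm se}^\star$. $\mathcal B$ is a fixed partition of the $m$ dual coordinates into blocks. $H_{BB}(\lambda)=\nabla^2_{BB}\phi_{\rm se}(\lambda)$ is the diagonal block of the Hessian indexed by $B$; $H^\star_{BB}=H_{BB}(\lambda^\star)$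 for a minimizer $\lambda^\star$ of $\phi_{\rm se}$ (the value is the same for every minimizer). $A_{B,j}$ is the $j$-th column of $A$ restricted to the rows in $B$, and $\rho_B=\max_j\|A_{B,j}\|_2$. $I_B$ is the identity of size $|B|$, $\preceq$ the Loewner order, $\|\cdot\|_2$ of a matrix its spectral norm. *)

theory Defs
  imports "HOL-Analysis.Analysis" "HOL-Library.Disjoint_Sets"
begin

definition partial_deriv :: "'m \<Rightarrow> (real^'m \<Rightarrow> real) \<Rightarrow> real^'m \<Rightarrow> real" where
  "partial_deriv i f x = deriv (\<lambda>t. f (x + t *\<^sub>R axis i 1)) 0"

definition hessian :: "(real^'m \<Rightarrow> real) \<Rightarrow> real^'m \<Rightarrow> real^'m^'m" where
  "hessian f x = (\<chi> i j. partial_deriv i (partial_deriv j f) x)"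

text \<open>
  A vector or matrix indexed by a block \<open>B\<close> of coordinates is represented by its extension
  by zero to all coordinates. Quadratic forms, Euclidean norms and spectral norms
  are the same as for the genuine \<open>B\<close>-indexed object, and \<open>M \<preceq> N\<close> holds for two such
  extensions iff it holds for the \<open>B\<close>-indexed matrices.
\<close>

definition block_vec :: "'m set \<Rightarrow> real^'m \<Rightarrow> real^'m" where
  "block_vec B v = (\<chi> i. if i \<in> B then v $ i else 0)"

definition block_mat :: "'m set \<Rightarrow> real^'m^'m \<Rightarrow> real^'m^'m" where
  "block_mat B M = (\<chi> i j. if i \<in> B \<and> j \<in> B then M $ i $ j else 0)"

abbreviation block_id :: "'m set \<Rightarrow> real^'m^'m" where
  "block_id B \<equiv> block_mat B (mat 1)"

definition psd :: "real^'m^'m \<Rightarrow> bool" where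
  "psd M \<longleftrightarrow> transpose M = M \<and> (\<forall>v. 0 \<le> v \<bullet> (M *v v))"

definition loewner_le :: "real^'m^'m \<Rightarrow> real^'m^'m \<Rightarrow> bool" (infix "\<preceq>" 50) where
  "M \<preceq> N \<longleftrightarrow> psd (N - M)"

definition spectral_norm :: "real^'m^'m \<Rightarrow> real" where
  "spectral_norm M = onorm (\<lambda>v. M *v v)"

definition phi_se :: "real^'n^'m \<Rightarrow> real^'m \<Rightarrow> real^'n \<Rightarrow> real \<Rightarrow> real^'m \<Rightarrow> real" where
  "phi_se A b c \<gamma> l =
     - (b \<bullet> l) + \<gamma> * (\<Sum>j\<in>UNIV. exp ((column j A \<bullet> l - c $ j) / \<gamma>))"

definition phi_se_star :: "real^'n^'m \<Rightarrow> real^'m \<Rightarrow> real^'n \<Rightarrow> real \<Rightarrow> real" where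
  "phi_se_star A b c \<gamma> = (INF l. phi_se A b c \<gamma> l)"

definition gap_se :: "real^'n^'m \<Rightarrow> real^'m \<Rightarrow> real^'n \<Rightarrow> real \<Rightarrow> real^'m \<Rightarrow> real" where
  "gap_se A b c \<gamma> l = phi_se A b c \<gamma> l - phi_se_star A b c \<gamma>"

definition hess_block ::
    "real^'n^'m \<Rightarrow> real^'m \<Rightarrow> real^'n \<Rightarrow> real \<Rightarrow> 'm set \<Rightarrow> real^'m \<Rightarrow> real^'m^'m" where
  "hess_block A b c \<gamma> B l = block_mat B (hessian (phi_se A b c \<gamma>) l)"

definition rho :: "real^'n^'m \<Rightarrow> 'm set \<Rightarrow> real" where
  "rho A B = (MAX j. norm (block_vec B (column j A)))"

definition c_theta :: "real \<Rightarrow> real" where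
  "c_theta \<theta> = \<theta> * ln (\<theta> / (\<theta> - 1))"

text \<open>Hence \<^const>\<open>phi_se_star\<close>, defined as an infimum, is a minimum.\<close>

lemma phi_se_min_attained:
  fixes A :: "real^'n^'m" and b :: "real^'m" and c :: "real^'n" and \<gamma> :: real
  assumes \<gamma>: "\<gamma> > 0" and xpos: "\<And>j. xbar $ j > 0" and xA: "A *v xbar = b"
  shows "\<exists>l. is_arg_min (phi_se A b c \<gamma>) (\<lambda>_. True) l"
proof -
  define T where "T = (\<lambda>l. transpose A *v l)"
  define h where "h = (\<lambda>j t. \<gamma> * exp ((t - c $ j) / \<gamma>) - xbar $ j * t)"
  define g where "g = (\<lambda>s::real^'n. \<Sum>j\<in>UNIV. h j (s $ j))"
  define D where "D = (\<lambda>j. 2 * xbar $ j * (\<gamma> - c $ j - \<gamma> * ln (2 * xbar $ j)))"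
  have colT: "column j A \<bullet> l = T l $ j" for j l
    by (simp add: T_def matrix_vector_mult_def column_def transpose_def inner_vec_def)
  have bl: "b \<bullet> l = (\<Sum>j\<in>UNIV. xbar $ j * T l $ j)" for l
  proof -
    have "b \<bullet> l = xbar \<bullet> T l"
      unfolding T_def xA[symmetric] by (metis dot_lmul_matrix inner_commute transpose_matrix_vector)
    then show ?thesis by (simp add: inner_vec_def)
  qed
  have phi: "phi_se A b c \<gamma> l = g (T l)" for l
    by (simp add: phi_se_def g_def h_def bl colT sum_subtractf sum_distrib_left)
  have lin: "linear T" unfolding T_def by simp
  have hlow: "xbar $ j * \<bar>t\<bar> - \<bar>D j\<bar> \<le> h j t" for j t
  proof -
    let ?x = "xbar $ j" and ?z = "(t - c $ j) / \<gamma>"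
    have x: "?x > 0" by (rule xpos)
    have "1 + (?z - ln (2 * ?x)) \<le> exp (?z - ln (2 * ?x))" by (rule exp_ge_add_one_self)
    also have "\<dots> = exp ?z / (2 * ?x)" using x by (simp add: exp_diff)
    finally have "2 * ?x * (1 + (?z - ln (2 * ?x))) \<le> exp ?z"
      using x by (simp add: field_simps)
    then have "\<gamma> * (2 * ?x * (1 + (?z - ln (2 * ?x)))) \<le> \<gamma> * exp ?z" using \<gamma> by simp
    moreover have "\<gamma> * (2 * ?x * (1 + (?z - ln (2 * ?x)))) = 2 * ?x * t + D j"
      using \<gamma> by (simp add: D_def field_simps)
    ultimately have 1: "?x * t + D j \<le> h j t" by (simp add: h_def ac_simps)
    have 2: "- (?x * t) \<le> h j t" using \<gamma> by (simp add: h_def)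
    show ?thesis using 1 2 x by (cases "t \<ge> 0") (auto simp: abs_if split: if_splits)
  qed
  define K where "K = {s \<in> range T. g s \<le> g 0}"
  have cont: "continuous_on UNIV g"
    unfolding g_def h_def using \<gamma> by (intro continuous_intros) auto
  have "closed (range T)"
    using lin by (intro closed_subspace linear_subspace_image) auto
  moreover have "closed {s. g s \<le> g 0}"
    using cont by (intro closed_Collect_le continuous_on_const)
  ultimately have "closed K" unfolding K_def by (auto intro: closed_Int simp: Collect_conj_eq)
  moreover have "bounded K"
  proof -
    define R where "R = g 0 + (\<Sum>j\<in>UNIV. \<bar>D j\<bar>)"
    have "norm s \<le> (\<Sum>j\<in>UNIV. R / xbar $ j)" if "s \<in> K" for s
    proof -
      have "(\<Sum>j\<in>UNIV. xbar $ j * \<bar>s $ j\<bar> - \<bar>D j\<bar>) \<le> g s"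
        unfolding g_def by (intro sum_mono hlow)
      then have tot: "(\<Sum>j\<in>UNIV. xbar $ j * \<bar>s $ j\<bar>) \<le> R"
        using that by (simp add: K_def R_def sum_subtractf)
      have "\<bar>s $ j\<bar> \<le> R / xbar $ j" for j
      proof -
        have "xbar $ j * \<bar>s $ j\<bar> \<le> (\<Sum>j\<in>UNIV. xbar $ j * \<bar>s $ j\<bar>)"
          using xpos[THEN less_imp_le] by (intro member_le_sum mult_nonneg_nonneg) auto
        with tot show ?thesis using xpos[of j] by (simp add: field_simps)
      qed
      then show ?thesis by (intro order_trans[OF norm_le_l1_cart] sum_mono)
    qed
    then show ?thesis by (auto simp: bounded_iff)
  qed
  ultimately have "compact K" by (simp add: compact_eq_bounded_closed)
  have T0: "T 0 = 0" using lin by (rule linear_0)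
  then have "0 \<in> K" unfolding K_def by (metis (mono_tags, lifting) mem_Collect_eq order_refl rangeI)
  obtain s where s: "s \<in> K" "\<And>u. u \<in> K \<Longrightarrow> g s \<le> g u"
    using continuous_attains_inf[OF \<open>compact K\<close>] \<open>0 \<in> K\<close> cont
    by (metis continuous_on_subset empty_iff subset_UNIV)
  then obtain l where l: "s = T l" by (auto simp: K_def)
  have "phi_se A b c \<gamma> l \<le> phi_se A b c \<gamma> k" for k
    using s \<open>0 \<in> K\<close> unfolding phi l[symmetric] K_def
    by (metis (mono_tags, lifting) linear mem_Collect_eq order_trans rangeI)
  then show ?thesis by (auto simp: is_arg_min_def not_less)
qed

end

theory Submission
  imports Defs
begin

text \<open>
  Write \<open>x\<^sub>j(\<lambda>) = exp ((a\<^sub>j \<bullet> \<lambda> - c\<^sub>j) / \<gamma>)\<close>. The Hessian of \<^const>\<open>phi_se\<close> is the weighted Gram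
  matrix \<open>(1/\<gamma>) \<Sum>\<^sub>j x\<^sub>j(\<lambda>) a\<^sub>j a\<^sub>j\<^sup>T\<close>, so the curvature at \<open>\<lambda>\<close> is controlled as soon as each weight
  \<open>x\<^sub>j(\<lambda>)\<close> is. Stationarity of the minimizer, \<open>\<Sum>\<^sub>j x\<^sub>j(\<lambda>\<^sup>\<star>) a\<^sub>j = b\<close>, removes \<open>b\<close> from the gap and turns
  it into a generalized Kullback-Leibler divergence (lemma \<open>gap_se_eq_divergence\<close>):
  \<open>F(\<lambda>) = \<gamma> \<Sum>\<^sub>j x\<^sub>j(\<lambda>\<^sup>\<star>) \<psi>(r\<^sub>j)\<close> with \<open>r\<^sub>j = x\<^sub>j(\<lambda>) / x\<^sub>j(\<lambda>\<^sup>\<star>)\<close> and \<open>\<psi>(r) = r - 1 - ln r \<ge> 0\<close>.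

  Since \<open>\<psi>\<close> grows linearly, a large ratio is paid for by the gap: \<open>r \<le> c\<^sub>\<theta> + \<theta> \<psi>(r)\<close>
  (lemma \<open>ratio_le_divergence\<close>). Multiplying by \<open>x\<^sub>j(\<lambda>\<^sup>\<star>)\<close> and summing against the squares
  \<open>(A\<^sub>B\<^sub>,\<^sub>j \<bullet> v)\<^sup>2\<close>, the first term reproduces \<open>c\<^sub>\<theta>\<close> times the Hessian at the minimizer. In the second,
  \<open>\<psi> \<ge> 0\<close> allows each square to be replaced by its Cauchy-Schwarz bound \<open>\<rho>\<^sub>B\<^sup>2 \<parallel>v\<^sub>B\<parallel>\<^sup>2\<close>, and what is
  left is the divergence, that is, the gap. The second claim is \<open>\<theta> = 2\<close> with
  the Hessian at the minimizer bounded by its spectral norm.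
\<close>

section \<open>Block matrices and the Loewner order\<close>

lemma loewner_leI:
  assumes "transpose M = M" and "transpose N = N"
    and "\<And>v. v \<bullet> (M *v v) \<le> v \<bullet> (N *v v)"
  shows "M \<preceq> N"
proof -
  have "transpose (N - M) = N - M"
    using assms(1,2) by (simp add: transpose_def vec_eq_iff)
  then show ?thesis
    using assms(3) by (simp add: loewner_le_def psd_def matrix_vector_mult_diff_rdistrib inner_diff_right)
qed

lemma transpose_block_mat: "transpose M = M \<Longrightarrow> transpose (block_mat B M) = block_mat B M"
  by (auto simp: transpose_def block_mat_def vec_eq_iff)

lemma transpose_scaleR: "transpose (k *\<^sub>R M) = k *\<^sub>R transpose (M :: real^'n^'m)"
  by (simp add: transpose_def vec_eq_iff)

lemma transpose_add: "transpose (M + N) = transpose M + transpose (N :: real^'n^'m)"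
  by (simp add: transpose_def vec_eq_iff)

lemma scaleR_matrix_vector: "(k *\<^sub>R M) *v v = k *\<^sub>R ((M :: real^'n^'m) *v v)"
  by (simp add: matrix_vector_mult_def vec_eq_iff sum_distrib_left mult.assoc)

lemma inner_block_vec: "block_vec B u \<bullet> v = block_vec B u \<bullet> block_vec B v"
  by (auto simp: inner_vec_def block_vec_def intro!: sum.cong)

lemma block_vec_idem: "block_vec B (block_vec B v) = block_vec B v"
  by (simp add: block_vec_def vec_eq_iff)

lemma block_mat_mult_vec: "block_mat B M *v v = block_vec B (M *v block_vec B v)"
proof -
  have "(\<Sum>j\<in>UNIV. (if i \<in> B \<and> j \<in> B then M $ i $ j else 0) * v $ j) =
      (if i \<in> B then \<Sum>j\<in>UNIV. M $ i $ j * (if j \<in> B then v $ j else 0) else 0)" for i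
    by (auto intro!: sum.cong)
  then show ?thesis
    by (simp add: matrix_vector_mult_def block_mat_def block_vec_def vec_eq_iff)
qed

lemma block_mat_quadratic_form:
  "v \<bullet> (block_mat B M *v v) = block_vec B v \<bullet> (block_mat B M *v block_vec B v)"
  unfolding block_mat_mult_vec block_vec_idem by (metis inner_block_vec inner_commute)

lemma block_id_quadratic_form: "v \<bullet> (block_id B *v v) = (norm (block_vec B v))\<^sup>2"
  by (subst block_mat_quadratic_form) (simp add: block_mat_mult_vec block_vec_idem dot_square_norm)

lemma quadratic_form_le_spectral_norm: "w \<bullet> (M *v w) \<le> spectral_norm M * (norm w)\<^sup>2"
proof -
  have "w \<bullet> (M *v w) \<le> norm w * norm (M *v w)"
    by (rule norm_cauchy_schwarz)
  also have "\<dots> \<le> norm w * (spectral_norm M * norm w)"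
    unfolding spectral_norm_def
    by (intro mult_left_mono onorm matrix_vector_mul_bounded_linear) auto
  finally show ?thesis
    by (simp add: power2_eq_square mult_ac)
qed

lemma norm_block_column_le_rho: "norm (block_vec B (column j A)) \<le> rho A B"
  unfolding rho_def by (rule Max_ge) auto

section \<open>Derivatives of the sum-exp dual\<close>

text \<open>
  The primal point recovered from a dual point \<open>l\<close>: up to the term in \<open>b\<close>, the gradient of
  \<^const>\<open>phi_se\<close> at \<open>l\<close> is \<open>A\<close> applied to it, so a dual minimizer recovers a solution of \<open>A x = b\<close>.
\<close>
definition primal_weight :: "real^'n^'m \<Rightarrow> real^'n \<Rightarrow> real \<Rightarrow> real^'m \<Rightarrow> 'n \<Rightarrow> real" where
  "primal_weight A c \<gamma> l j = exp ((column j A \<bullet> l - c $ j) / \<gamma>)"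

lemma primal_weight_pos: "primal_weight A c \<gamma> l j > 0"
  by (simp add: primal_weight_def)

lemma primal_weight_line_deriv:
  "((\<lambda>t. primal_weight A c \<gamma> (x + t *\<^sub>R d) j) has_real_derivative
      primal_weight A c \<gamma> x j * (column j A \<bullet> d) / \<gamma>) (at 0)"
  unfolding primal_weight_def inner_add_right inner_scaleR_right divide_inverse
  by (auto intro!: derivative_eq_intros)

lemma phi_se_line_deriv:
  assumes "\<gamma> > 0"
  shows "((\<lambda>t. phi_se A b c \<gamma> (x + t *\<^sub>R d)) has_real_derivative
      (\<Sum>j\<in>UNIV. primal_weight A c \<gamma> x j * (column j A \<bullet> d)) - b \<bullet> d) (at 0)"
proof -
  have "((\<lambda>t. - (b \<bullet> x + t * (b \<bullet> d)) + \<gamma> * (\<Sum>j\<in>UNIV. primal_weight A c \<gamma> (x + t *\<^sub>R d) j))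
      has_real_derivative
        - (b \<bullet> d) + \<gamma> * (\<Sum>j\<in>UNIV. primal_weight A c \<gamma> x j * (column j A \<bullet> d) / \<gamma>)) (at 0)"
    by (auto intro!: derivative_eq_intros primal_weight_line_deriv)
  then show ?thesis
    using assms by (simp add: phi_se_def primal_weight_def inner_add_right sum_distrib_left)
qed

lemma partial_deriv_phi_se:
  assumes "\<gamma> > 0"
  shows "partial_deriv i (phi_se A b c \<gamma>) =
      (\<lambda>x. (\<Sum>k\<in>UNIV. primal_weight A c \<gamma> x k * A $ i $ k) - b $ i)"
  unfolding partial_deriv_def DERIV_imp_deriv[OF phi_se_line_deriv[OF assms]]
  by (simp add: inner_axis column_def)

lemma hessian_phi_se:
  assumes "\<gamma> > 0"
  shows "hessian (phi_se A b c \<gamma>) l =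
      (\<chi> i j. \<Sum>k\<in>UNIV. primal_weight A c \<gamma> l k / \<gamma> * A $ i $ k * A $ j $ k)"
proof -
  have "((\<lambda>t. (\<Sum>k\<in>UNIV. primal_weight A c \<gamma> (l + t *\<^sub>R axis i 1) k * A $ j $ k) - b $ j)
      has_real_derivative (\<Sum>k\<in>UNIV. primal_weight A c \<gamma> l k / \<gamma> * A $ i $ k * A $ j $ k)) (at 0)"
    for i j
    by (auto intro!: derivative_eq_intros primal_weight_line_deriv sum.cong
        simp: inner_axis column_def)
  then show ?thesis
    unfolding hessian_def partial_deriv_phi_se[OF assms] partial_deriv_def
    by (simp add: vec_eq_iff DERIV_imp_deriv)
qed

lemma transpose_hess_block:
  assumes "\<gamma> > 0"
  shows "transpose (hess_block A b c \<gamma> B l) = hess_block A b c \<gamma> B l"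
  unfolding hess_block_def hessian_phi_se[OF assms]
  by (intro transpose_block_mat) (simp add: transpose_def vec_eq_iff mult_ac)

text \<open>
  The block Hessian is linear in the primal weights, with squares as coefficients; this is what
  lets scalar bounds on the weights become Loewner bounds.
\<close>
lemma hess_block_quadratic_form:
  assumes "\<gamma> > 0"
  shows "v \<bullet> (hess_block A b c \<gamma> B l *v v) =
      (\<Sum>k\<in>UNIV. primal_weight A c \<gamma> l k * (block_vec B (column k A) \<bullet> v)\<^sup>2) / \<gamma>"
proof -
  let ?p = "primal_weight A c \<gamma> l" and ?u = "\<lambda>k. block_vec B (column k A)"
  have entry: "hess_block A b c \<gamma> B l $ i $ j = (\<Sum>k\<in>UNIV. ?p k / \<gamma> * ?u k $ i * ?u k $ j)" for i j
    by (cases "i \<in> B"; cases "j \<in> B")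
      (simp_all add: hess_block_def hessian_phi_se[OF assms] block_mat_def block_vec_def column_def)
  have "v \<bullet> (hess_block A b c \<gamma> B l *v v) =
      (\<Sum>i\<in>UNIV. \<Sum>j\<in>UNIV. \<Sum>k\<in>UNIV. ?p k / \<gamma> * (?u k $ i * v $ i) * (?u k $ j * v $ j))"
    by (simp add: inner_vec_def matrix_vector_mult_def entry sum_distrib_left sum_distrib_right mult_ac)
  also have "\<dots> = (\<Sum>i\<in>UNIV. \<Sum>k\<in>UNIV. \<Sum>j\<in>UNIV. ?p k / \<gamma> * (?u k $ i * v $ i) * (?u k $ j * v $ j))"
    by (intro sum.cong refl sum.swap)
  also have "\<dots> = (\<Sum>k\<in>UNIV. \<Sum>i\<in>UNIV. \<Sum>j\<in>UNIV. ?p k / \<gamma> * (?u k $ i * v $ i) * (?u k $ j * v $ j))"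
    by (rule sum.swap)
  also have "\<dots> = (\<Sum>k\<in>UNIV. ?p k / \<gamma> * (?u k \<bullet> v)\<^sup>2)"
    unfolding inner_vec_def inner_real_def power2_eq_square sum_product
    by (simp add: sum_distrib_left mult.assoc)
  finally show ?thesis
    by (simp add: sum_divide_distrib)
qed

section \<open>The optimality gap as a divergence\<close>

lemma phi_se_minimizer_stationary:
  assumes "\<gamma> > 0" and "is_arg_min (phi_se A b c \<gamma>) (\<lambda>_. True) lstar"
  shows "(\<Sum>j\<in>UNIV. primal_weight A c \<gamma> lstar j * (column j A \<bullet> d)) = b \<bullet> d"
proof -
  have "\<forall>t. \<bar>0 - t\<bar> < 1 \<longrightarrow>
      phi_se A b c \<gamma> (lstar + 0 *\<^sub>R d) \<le> phi_se A b c \<gamma> (lstar + t *\<^sub>R d)"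
    using assms(2) by (auto simp: is_arg_min_def not_less)
  then have "(\<Sum>j\<in>UNIV. primal_weight A c \<gamma> lstar j * (column j A \<bullet> d)) - b \<bullet> d = 0"
    by (rule DERIV_local_min[OF phi_se_line_deriv[OF assms(1)] zero_less_one])
  then show ?thesis
    by simp
qed

lemma phi_se_star_eq_minimum:
  assumes "is_arg_min (phi_se A b c \<gamma>) (\<lambda>_. True) lstar"
  shows "phi_se_star A b c \<gamma> = phi_se A b c \<gamma> lstar"
  unfolding phi_se_star_def
  using assms by (intro cInf_eq_minimum) (auto simp: is_arg_min_def not_less)

text \<open>
  Stationarity in the direction \<open>l - lstar\<close> expresses \<open>b \<bullet> (l - lstar)\<close> through
  \<open>a\<^sub>j \<bullet> (l - lstar)\<close>, which is \<open>\<gamma>\<close> times the logarithm of the ratio of the two weights.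
\<close>
lemma gap_se_eq_divergence:
  fixes l :: "real^'m"
  assumes "\<gamma> > 0" and "is_arg_min (phi_se A b c \<gamma>) (\<lambda>_. True) lstar"
  defines "p \<equiv> primal_weight A c \<gamma> lstar"
  defines "r \<equiv> \<lambda>j. primal_weight A c \<gamma> l j / p j"
  shows "gap_se A b c \<gamma> l = \<gamma> * (\<Sum>j\<in>UNIV. p j * (r j - 1 - ln (r j)))"
proof -
  have p: "p j > 0" for j
    by (simp add: p_def primal_weight_pos)
  have "column j A \<bullet> (l - lstar) = \<gamma> * ln (r j)" for j
    using assms(1)
    by (simp add: r_def p_def primal_weight_def exp_diff[symmetric] inner_diff_right field_simps)
  then have "b \<bullet> (l - lstar) = (\<Sum>j\<in>UNIV. p j * (\<gamma> * ln (r j)))"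
    using phi_se_minimizer_stationary[OF assms(1,2), of "l - lstar"] by (simp add: p_def)
  moreover have "primal_weight A c \<gamma> l j = p j * r j" for j
    using p[of j] by (simp add: r_def)
  ultimately show ?thesis
    unfolding gap_se_def phi_se_star_eq_minimum[OF assms(2)] phi_se_def
      primal_weight_def[symmetric] p_def[symmetric]
    by (simp add: inner_diff_right algebra_simps sum.distrib sum_subtractf sum_distrib_left)
qed

section \<open>Majorizing the Hessian blocks\<close>

text \<open>
  The difference of the two sides is convex in \<open>r\<close> and vanishes, together with its derivative, at
  \<open>r = \<theta> / (\<theta> - 1)\<close>; the inequality \<open>ln t \<le> t - 1\<close> at \<open>t = r (\<theta> - 1) / \<theta>\<close> says just this.
\<close>
lemma ratio_le_divergence:
  fixes r \<theta> :: real
  assumes "r > 0" and "\<theta> > 1"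
  shows "r \<le> c_theta \<theta> + \<theta> * (r - 1 - ln r)"
proof -
  have "ln (r / (\<theta> / (\<theta> - 1))) \<le> r / (\<theta> / (\<theta> - 1)) - 1"
    using assms by (intro ln_le_minus_one) simp
  moreover have "ln (r / (\<theta> / (\<theta> - 1))) = ln r - ln (\<theta> / (\<theta> - 1))"
    using assms by (intro ln_divide_pos) auto
  ultimately have "\<theta> * (ln r - ln (\<theta> / (\<theta> - 1))) \<le> \<theta> * (r / (\<theta> / (\<theta> - 1)) - 1)"
    using assms(2) by (intro mult_left_mono) auto
  also have "\<dots> = r * (\<theta> - 1) - \<theta>"
    using assms(2) by (simp add: field_simps)
  finally show ?thesis
    by (simp add: c_theta_def algebra_simps)
qed

lemma hess_block_quadratic_form_le:
  assumes "\<gamma> > 0" and "is_arg_min (phi_se A b c \<gamma>) (\<lambda>_. True) lstar" and "\<theta> > 1"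
  shows "v \<bullet> (hess_block A b c \<gamma> B l *v v) \<le>
      c_theta \<theta> * (v \<bullet> (hess_block A b c \<gamma> B lstar *v v))
      + \<theta> * (rho A B)\<^sup>2 / \<gamma>\<^sup>2 * gap_se A b c \<gamma> l * (norm (block_vec B v))\<^sup>2"
proof -
  define p where "p = primal_weight A c \<gamma> lstar"
  define r where "r = (\<lambda>j. primal_weight A c \<gamma> l j / p j)"
  define \<psi> where "\<psi> = (\<lambda>j. r j - 1 - ln (r j))"
  define s where "s = (\<lambda>j. (block_vec B (column j A) \<bullet> v)\<^sup>2)"
  define K where "K = (rho A B)\<^sup>2 * (norm (block_vec B v))\<^sup>2"
  have p: "p j > 0" and r: "r j > 0" for j
    by (simp_all add: p_def r_def primal_weight_pos)
  have \<psi>: "\<psi> j \<ge> 0" for j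
    using ln_le_minus_one[OF r[of j]] by (simp add: \<psi>_def)
  have s_le: "s j \<le> K" for j
  proof -
    have "\<bar>block_vec B (column j A) \<bullet> v\<bar> \<le> norm (block_vec B (column j A)) * norm (block_vec B v)"
      by (subst inner_block_vec) (rule Cauchy_Schwarz_ineq2)
    also have "\<dots> \<le> rho A B * norm (block_vec B v)"
      by (intro mult_right_mono norm_block_column_le_rho) simp
    finally show ?thesis
      unfolding s_def K_def power_mult_distrib[symmetric]
      by (intro abs_le_square_iff[THEN iffD1]) linarith
  qed
  have weight: "primal_weight A c \<gamma> l j * s j \<le> c_theta \<theta> * (p j * s j) + \<theta> * K * (p j * \<psi> j)" for j
  proof -
    have "primal_weight A c \<gamma> l j * s j = p j * s j * r j"
      using p[of j] by (simp add: r_def)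
    also have "\<dots> \<le> p j * s j * (c_theta \<theta> + \<theta> * \<psi> j)"
      using p[of j] ratio_le_divergence[OF r[of j] assms(3)]
      by (intro mult_left_mono) (auto simp: \<psi>_def s_def)
    also have "\<dots> = c_theta \<theta> * (p j * s j) + \<theta> * (p j * \<psi> j) * s j"
      by (simp add: algebra_simps)
    also have "\<dots> \<le> c_theta \<theta> * (p j * s j) + \<theta> * (p j * \<psi> j) * K"
      using p[of j] \<psi>[of j] assms(3) s_le[of j] by (intro add_left_mono mult_left_mono) auto
    finally show ?thesis
      by (simp add: mult_ac)
  qed
  have gap: "(\<Sum>j\<in>UNIV. p j * \<psi> j) = gap_se A b c \<gamma> l / \<gamma>"
    using gap_se_eq_divergence[OF assms(1,2), of l] assms(1) by (simp add: p_def r_def \<psi>_def)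
  have "(\<Sum>j\<in>UNIV. primal_weight A c \<gamma> l j * s j)
      \<le> (\<Sum>j\<in>UNIV. c_theta \<theta> * (p j * s j) + \<theta> * K * (p j * \<psi> j))"
    by (intro sum_mono weight)
  also have "\<dots> = c_theta \<theta> * (\<Sum>j\<in>UNIV. p j * s j) + \<theta> * K * (gap_se A b c \<gamma> l / \<gamma>)"
    by (simp add: sum.distrib sum_distrib_left[symmetric] gap)
  finally have "(\<Sum>j\<in>UNIV. primal_weight A c \<gamma> l j * s j) / \<gamma>
      \<le> (c_theta \<theta> * (\<Sum>j\<in>UNIV. p j * s j) + \<theta> * K * (gap_se A b c \<gamma> l / \<gamma>)) / \<gamma>"
    using assms(1) by (intro divide_right_mono) auto
  then show ?thesis
    unfolding hess_block_quadratic_form[OF assms(1)]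
    by (simp add: s_def p_def K_def add_divide_distrib power2_eq_square mult_ac)
qed

theorem theorem3p1:
  fixes A :: "real^'n^'m" and b q lstar :: "real^'m" and c xbar :: "real^'n" and \<gamma> :: real
    and \<B> :: "'m set set"
  assumes "\<gamma> > 0"
    and "transpose A *v q = (\<chi> j. 1)" and "q \<bullet> b = 1"
    and "\<forall>j. xbar $ j > 0" and "A *v xbar = b"
    and "partition_on UNIV \<B>"
    and "is_arg_min (phi_se A b c \<gamma>) (\<lambda>_. True) lstar"
  shows "(\<forall>\<theta>>1. \<forall>B\<in>\<B>. \<forall>l.
            hess_block A b c \<gamma> B l \<preceq>
              c_theta \<theta> *\<^sub>R hess_block A b c \<gamma> B lstar
              + (\<theta> * (rho A B)\<^sup>2 / \<gamma>\<^sup>2 * gap_se A b c \<gamma> l) *\<^sub>R block_id B)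
       \<and> (\<forall>B\<in>\<B>. \<forall>Hbar \<ge> spectral_norm (hess_block A b c \<gamma> B lstar).
            let \<kappa> = 2 * ln 2 * Hbar; \<nu> = 2 * (rho A B)\<^sup>2 / \<gamma>\<^sup>2
            in \<forall>l. hess_block A b c \<gamma> B l \<preceq> (\<kappa> + \<nu> * gap_se A b c \<gamma> l) *\<^sub>R block_id B)"
proof (intro conjI allI impI ballI)
  note transpose_simps = transpose_hess_block[OF assms(1)] transpose_block_mat
    transpose_scaleR transpose_add
  note form_simps = matrix_vector_mult_add_rdistrib scaleR_matrix_vector inner_add_right
    block_id_quadratic_form
  fix B
  {
    fix \<theta> :: real and l assume "\<theta> > 1"
    then show "hess_block A b c \<gamma> B l \<preceq> c_theta \<theta> *\<^sub>R hess_block A b c \<gamma> B lstar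
        + (\<theta> * (rho A B)\<^sup>2 / \<gamma>\<^sup>2 * gap_se A b c \<gamma> l) *\<^sub>R block_id B"
      using hess_block_quadratic_form_le[OF assms(1,7)]
      by (intro loewner_leI) (simp_all add: transpose_simps form_simps)
  next
    fix Hbar assume Hbar: "spectral_norm (hess_block A b c \<gamma> B lstar) \<le> Hbar"
    have "hess_block A b c \<gamma> B l \<preceq>
        (2 * ln 2 * Hbar + 2 * (rho A B)\<^sup>2 / \<gamma>\<^sup>2 * gap_se A b c \<gamma> l) *\<^sub>R block_id B" for l
    proof (rule loewner_leI)
      fix v
      let ?H = "hess_block A b c \<gamma> B lstar" and ?w = "block_vec B v"
      \<comment> \<open>The spectral norm bound is applied to the restricted vector: against
        \<^term>\<open>v\<close> itself it would give the full norm instead of the block norm.\<close>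
      have "v \<bullet> (?H *v v) = ?w \<bullet> (?H *v ?w)"
        unfolding hess_block_def by (rule block_mat_quadratic_form)
      also have "\<dots> \<le> spectral_norm ?H * (norm ?w)\<^sup>2"
        by (rule quadratic_form_le_spectral_norm)
      also have "\<dots> \<le> Hbar * (norm ?w)\<^sup>2"
        using Hbar by (rule mult_right_mono) simp
      finally have "2 * ln 2 * (v \<bullet> (?H *v v)) \<le> 2 * ln 2 * (Hbar * (norm ?w)\<^sup>2)"
        by (intro mult_left_mono) auto
      moreover have "v \<bullet> (hess_block A b c \<gamma> B l *v v) \<le> 2 * ln 2 * (v \<bullet> (?H *v v))
          + 2 * (rho A B)\<^sup>2 / \<gamma>\<^sup>2 * gap_se A b c \<gamma> l * (norm ?w)\<^sup>2"
        using hess_block_quadratic_form_le[OF assms(1,7), of 2 v B l] by (simp add: c_theta_def)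
      ultimately show "v \<bullet> (hess_block A b c \<gamma> B l *v v) \<le>
          v \<bullet> (((2 * ln 2 * Hbar + 2 * (rho A B)\<^sup>2 / \<gamma>\<^sup>2 * gap_se A b c \<gamma> l) *\<^sub>R block_id B) *v v)"
        unfolding form_simps inner_scaleR_right distrib_right mult.assoc by linarith
    qed (simp_all add: transpose_simps)
    then show "let \<kappa> = 2 * ln 2 * Hbar; \<nu> = 2 * (rho A B)\<^sup>2 / \<gamma>\<^sup>2
        in \<forall>l. hess_block A b c \<gamma> B l \<preceq> (\<kappa> + \<nu> * gap_se A b c \<gamma> l) *\<^sub>R block_id B"
      by (simp add: Let_def)
  }
qed

end
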